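(* Let $n,l\ge 1$ and let $\sigma=(n_1,n_2,\dots,n_l)\in S_l(n)$ be a partition of $n$ with $l$ distinct parts. Then $\delta(\sigma)=\delta^{\ast}(\sigma)=0$ if and only if either ($m(\sigma)=l$ and $n_l=m(\sigma)$) or ($m(\sigma)=l$ and $n_l=m(\sigma)+1$).
   Context: For a positive integer $n$, let $S_l(n)$ be the set of tuples $\sigma=(n_1,\dots,n_l)$ of positive integers with $n_1>n_2>\cdots>n_l>0$ and $n_1+\cdots+n_l=n$ (partitions of $n$ into $l$ distinct parts), and let $CS_l(n)=\bigoplus_{\sigma\in S_l(n)}\mathbb{R}\sigma$ be the real vector space with basis $S_l(n)$ (so $CS_l(n)=0$ if $l\le 0$). For $\sigma=(n_1,\dots,n_l)\in S_l(n)$, $m(\sigma)$ is the largest integer $m$ with $1\le m\le l$ such that $n_j=n_{j-1}-1$ for all $j=2,\dots,m$ (so $m(\sigma)=1$ if $l=1$). The linear map $\delta:CS_l(n)\to CS_{l+1}(n)$ is determined on a basis element $\sigma=(n_1,\dots,n_l)$, with $m=m(\sigma)$, by: (i) If $m<l$: $\delta(\sigma)=0$ when $m\ge n_l$; and $\delta(\sigma)=(n_1-1,\dots,n_m-1,n_{m+1},\dots,n_l,m)$ when $m<n_l$. (ii) If $m=l$: $\delta(\sigma)=0$ when $m\ge n_l-1$; and $\delta(\sigma)=(n_1-1,\dots,n_m-1,m)$ when $m<n_l-1$. The linear map $\delta^{\ast}:CS_l(n)\to CS_{l-1}(n)$ is determined on a basis element $\sigma=(n_1,\dots,n_l)$,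 with $m=m(\sigma)$ and $r=n_l$, by: (i) If $m<l$: $\delta^{\ast}(\sigma)=0$ when $m<n_l$; and $\delta^{\ast}(\sigma)=(n_1+1,\dots,n_r+1,n_{r+1},\dots,n_{l-1})$ when $m\ge n_l$. (ii) If $m=l$: $\delta^{\ast}(\sigma)=0$ when $m\le n_l$; and $\delta^{\ast}(\sigma)=(n_1+1,\dots,n_r+1,n_{r+1},\dots,n_{l-1})$ when $m>n_l$. *)

theory Defs
  imports Complex_Main "HOL-Library.Poly_Mapping"
begin

text \<open>The free real vector space on a type: finitely supported functions with
  pointwise scaling.\<close>

instantiation poly_mapping :: (type, real_vector) real_vector
begin

definition scaleR_poly_mapping :: "real \<Rightarrow> ('a \<Rightarrow>\<^sub>0 'b) \<Rightarrow> ('a \<Rightarrow>\<^sub>0 'b)" where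
  "scaleR_poly_mapping c v = Poly_Mapping.map (\<lambda>x. c *\<^sub>R x) v"

lemma lookup_scaleR [simp]:
  "Poly_Mapping.lookup (c *\<^sub>R v) k = c *\<^sub>R Poly_Mapping.lookup v k"
  unfolding scaleR_poly_mapping_def by (simp add: Poly_Mapping.map.rep_eq when_def)

instance
  by standard (auto intro!: poly_mapping_eqI simp: lookup_add scaleR_add_left scaleR_add_right)

end

definition basis_vec :: "'a \<Rightarrow> ('a \<Rightarrow>\<^sub>0 real)" where
  "basis_vec \<sigma> = Poly_Mapping.single \<sigma> 1"

definition linear_extension :: "('a \<Rightarrow> 'b::real_vector) \<Rightarrow> ('a \<Rightarrow>\<^sub>0 real) \<Rightarrow> 'b" where
  "linear_extension f v = (\<Sum>\<sigma>\<in>Poly_Mapping.keys v. Poly_Mapping.lookup v \<sigma> *\<^sub>R f \<sigma>)"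

lemma linear_extension_superset:
  assumes "finite A" "Poly_Mapping.keys v \<subseteq> A"
  shows "linear_extension f v = (\<Sum>\<sigma>\<in>A. Poly_Mapping.lookup v \<sigma> *\<^sub>R f \<sigma>)"
  unfolding linear_extension_def
  by (rule sum.mono_neutral_left) (use assms in \<open>auto simp: in_keys_iff\<close>)

lemma linear_linear_extension: "linear (linear_extension f)"
proof (rule linearI)
  fix u v :: "'a \<Rightarrow>\<^sub>0 real" and c :: real
  let ?A = "Poly_Mapping.keys u \<union> Poly_Mapping.keys v"
  have "Poly_Mapping.keys (u + v) \<subseteq> ?A" by (rule Poly_Mapping.keys_add)
  then show "linear_extension f (u + v) = linear_extension f u + linear_extension f v"
    by (simp add: linear_extension_superset[of ?A] lookup_add scaleR_add_left sum.distrib)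
  have "Poly_Mapping.keys (c *\<^sub>R v) \<subseteq> Poly_Mapping.keys v"
    by (auto simp: in_keys_iff)
  then show "linear_extension f (c *\<^sub>R v) = c *\<^sub>R linear_extension f v"
    by (simp add: linear_extension_superset[of "Poly_Mapping.keys v"] scaleR_sum_right)
qed

lemma linear_extension_basis_vec [simp]: "linear_extension f (basis_vec \<sigma>) = f \<sigma>"
  by (simp add: linear_extension_def basis_vec_def)

text \<open>Partitions into distinct parts are strictly decreasing lists.\<close>

definition S :: "nat \<Rightarrow> nat \<Rightarrow> nat list set" where
  "S l n = {\<sigma>. length \<sigma> = l \<and> sorted_wrt (>) \<sigma> \<and> (\<forall>x\<in>set \<sigma>. 0 < x) \<and> sum_list \<sigma> = n}"

definition CS :: "nat \<Rightarrow> nat \<Rightarrow> (nat list \<Rightarrow>\<^sub>0 real) set" where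
  "CS l n = {v. Poly_Mapping.keys v \<subseteq> S l n}"

text \<open>The parts are numbered from 1, so \<open>part \<sigma> j\<close> is $n_j$.\<close>

definition part :: "nat list \<Rightarrow> nat \<Rightarrow> nat" where
  "part \<sigma> j = \<sigma> ! (j - 1)"

definition m_stat :: "nat list \<Rightarrow> nat" where
  "m_stat \<sigma> = Max {m. 1 \<le> m \<and> m \<le> length \<sigma> \<and> (\<forall>j\<in>{2..m}. part \<sigma> j = part \<sigma> (j - 1) - 1)}"

text \<open>Natural subtraction is harmless in these definitions, since all parts of a partition
  are positive.\<close>

definition delta_basis :: "nat list \<Rightarrow> (nat list \<Rightarrow>\<^sub>0 real)" where
  "delta_basis \<sigma> = (let l = length \<sigma>; m = m_stat \<sigma> in
     if m < l then
       (if m \<ge> part \<sigma> l then 0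
        else basis_vec (map (\<lambda>x. x - 1) (take m \<sigma>) @ drop m \<sigma> @ [m]))
     else
       (if m \<ge> part \<sigma> l - 1 then 0
        else basis_vec (map (\<lambda>x. x - 1) (take m \<sigma>) @ [m])))"

definition delta_star_basis :: "nat list \<Rightarrow> (nat list \<Rightarrow>\<^sub>0 real)" where
  "delta_star_basis \<sigma> = (let l = length \<sigma>; m = m_stat \<sigma>; r = part \<sigma> l;
       \<tau> = map (\<lambda>x. x + 1) (take r (butlast \<sigma>)) @ drop r (butlast \<sigma>) in
     if m < l then (if m < r then 0 else basis_vec \<tau>)
     else (if m \<le> r then 0 else basis_vec \<tau>))"

definition delta :: "(nat list \<Rightarrow>\<^sub>0 real) \<Rightarrow> (nat list \<Rightarrow>\<^sub>0 real)" where
  "delta = linear_extension delta_basis"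

definition delta_star :: "(nat list \<Rightarrow>\<^sub>0 real) \<Rightarrow> (nat list \<Rightarrow>\<^sub>0 real)" where
  "delta_star = linear_extension delta_star_basis"

lemma linear_delta: "linear delta" and linear_delta_star: "linear delta_star"
  by (simp_all add: delta_def delta_star_def linear_linear_extension)

lemma subspace_CS: "subspace (CS l n)"
proof (rule subspaceI)
  fix u v :: "nat list \<Rightarrow>\<^sub>0 real"
  assume "u \<in> CS l n" "v \<in> CS l n"
  then show "u + v \<in> CS l n"
    using Poly_Mapping.keys_add[of u v] unfolding CS_def by blast
next
  fix c and v :: "nat list \<Rightarrow>\<^sub>0 real"
  assume "v \<in> CS l n"
  moreover have "Poly_Mapping.keys (c *\<^sub>R v) \<subseteq> Poly_Mapping.keys v"
    by (auto simp: in_keys_iff)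
  ultimately show "c *\<^sub>R v \<in> CS l n" unfolding CS_def by blast
qed (simp add: CS_def)

lemma CS_0: "0 < n \<Longrightarrow> CS 0 n = {0}"
proof -
  assume "0 < n"
  then have "S 0 n = {}" by (auto simp: S_def)
  then show ?thesis by (auto simp: CS_def)
qed

lemma basis_vec_in_CS: "basis_vec \<sigma> \<in> CS l n \<longleftrightarrow> \<sigma> \<in> S l n"
  by (simp add: CS_def basis_vec_def)

lemma m_stat_props:
  assumes "0 < length \<sigma>"
  shows "1 \<le> m_stat \<sigma>" "m_stat \<sigma> \<le> length \<sigma>"
    "\<forall>j\<in>{2..m_stat \<sigma>}. part \<sigma> j = part \<sigma> (j - 1) - 1"
    "m_stat \<sigma> < length \<sigma> \<Longrightarrow> part \<sigma> (Suc (m_stat \<sigma>)) \<noteq> part \<sigma> (m_stat \<sigma>) - 1"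
proof -
  let ?M = "{m. 1 \<le> m \<and> m \<le> length \<sigma> \<and> (\<forall>j\<in>{2..m}. part \<sigma> j = part \<sigma> (j - 1) - 1)}"
  have fin: "finite ?M" by (rule finite_subset[of _ "{..length \<sigma>}"]) auto
  have "1 \<in> ?M" using assms by (auto simp: Suc_le_eq)
  then have "m_stat \<sigma> \<in> ?M" unfolding m_stat_def using fin by (intro Max_in) auto
  then show 1: "1 \<le> m_stat \<sigma>" "m_stat \<sigma> \<le> length \<sigma>"
    "\<forall>j\<in>{2..m_stat \<sigma>}. part \<sigma> j = part \<sigma> (j - 1) - 1" by auto
  assume lt: "m_stat \<sigma> < length \<sigma>"
  show "part \<sigma> (Suc (m_stat \<sigma>)) \<noteq> part \<sigma> (m_stat \<sigma>) - 1"
  proof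
    assume "part \<sigma> (Suc (m_stat \<sigma>)) = part \<sigma> (m_stat \<sigma>) - 1"
    then have "Suc (m_stat \<sigma>) \<in> ?M" using 1 lt by (auto simp: le_Suc_eq)
    then have "Suc (m_stat \<sigma>) \<le> m_stat \<sigma>"
      unfolding m_stat_def using fin Max_ge by blast
    then show False by simp
  qed
qed

lemma sum_list_pred:
  "\<forall>x\<in>set xs. 0 < x \<Longrightarrow> sum_list (map (\<lambda>x. x - 1) xs) + length xs = sum_list (xs :: nat list)"
  by (induction xs) auto

lemma sum_list_succ: "sum_list (map (\<lambda>x. x + 1) xs) = sum_list (xs :: nat list) + length xs"
  by (induction xs) auto

lemma sum_list_take_drop: "sum_list (take k xs) + sum_list (drop k xs) = sum_list (xs :: nat list)"
  by (simp flip: sum_list_append)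

lemma delta_basis_in_CS:
  assumes "\<sigma> \<in> S l n" "0 < l"
  shows "delta_basis \<sigma> \<in> CS (Suc l) n"
proof -
  let ?m = "m_stat \<sigma>"
  have len: "length \<sigma> = l" and srt: "sorted_wrt (>) \<sigma>" and pos: "\<forall>x\<in>set \<sigma>. 0 < x"
    and sm: "sum_list \<sigma> = n" using assms by (auto simp: S_def)
  note m = m_stat_props[of \<sigma>, unfolded len, OF \<open>0 < l\<close>]
  have anti: "\<sigma> ! j < \<sigma> ! i" if "i < j" "j < l" for i j
    using srt that len by (simp add: sorted_wrt_iff_nth_less)
  have antile: "\<sigma> ! j \<le> \<sigma> ! i" if "i \<le> j" "j < l" for i j
    using anti[of i j] that by (cases "i = j") auto
  have min: "part \<sigma> l \<le> x" if "x \<in> set \<sigma>" for x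
    using that antile[of _ "l - 1"] len \<open>0 < l\<close> by (auto simp: in_set_conv_nth part_def)
  have srt_pred: "sorted_wrt (>) (map (\<lambda>x. x - 1) (take ?m \<sigma>))"
    unfolding sorted_wrt_map
  proof (rule sorted_wrt_mono_rel[OF _ sorted_wrt_take[OF srt]])
    fix x y assume "y \<in> set (take ?m \<sigma>)" "x > y"
    moreover from this have "0 < y" using pos by (auto dest: in_set_takeD)
    ultimately show "x - 1 > y - 1" by linarith
  qed
  have sm_pred: "sum_list (map (\<lambda>x. x - 1) (take ?m \<sigma>)) + ?m = sum_list (take ?m \<sigma>)"
  proof -
    have "\<forall>x\<in>set (take ?m \<sigma>). 0 < x" using pos by (auto dest: in_set_takeD)
    from sum_list_pred[OF this] show ?thesis using m(2) len by simp
  qed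
  show ?thesis
  proof (cases "?m < l")
    case True
    have gap: "y < x - 1" if x: "x \<in> set (take ?m \<sigma>)" and y: "y \<in> set (drop ?m \<sigma>)" for x y
    proof -
      obtain i where "i < length (take ?m \<sigma>)" "x = take ?m \<sigma> ! i"
        using x unfolding in_set_conv_nth by blast
      then have i: "i < ?m" "x = \<sigma> ! i" by auto
      obtain k where "k < length (drop ?m \<sigma>)" "y = drop ?m \<sigma> ! k"
        using y unfolding in_set_conv_nth by blast
      then have k: "?m + k < l" "y = \<sigma> ! (?m + k)" using len True by auto
      have "\<sigma> ! ?m < \<sigma> ! (?m - 1)" using anti[of "?m - 1" ?m] m(1) True by simp
      moreover have "\<sigma> ! ?m \<noteq> \<sigma> ! (?m - 1) - 1"
        using m(4)[OF True] by (simp add: part_def)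
      moreover have "y \<le> \<sigma> ! ?m" using antile[of ?m "?m + k"] k by simp
      moreover have "\<sigma> ! (?m - 1) \<le> x" using antile[of i "?m - 1"] i True by simp
      ultimately show ?thesis by linarith
    qed
    have "map (\<lambda>x. x - 1) (take ?m \<sigma>) @ drop ?m \<sigma> @ [?m] \<in> S (Suc l) n" if a: "?m < part \<sigma> l"
    proof -
      have ne: "drop ?m \<sigma> \<noteq> []" using True len by simp
      have d: "?m < y" if "y \<in> set (drop ?m \<sigma>)" for y
        using min[OF in_set_dropD[OF that]] a by simp
      have t: "?m < x - 1" if "x \<in> set (take ?m \<sigma>)" for x
        using gap[OF that last_in_set[OF ne]] d[OF last_in_set[OF ne]] by linarith
      have "sorted_wrt (>) (drop ?m \<sigma>)" by (rule sorted_wrt_drop[OF srt])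
      then have "sorted_wrt (>) (map (\<lambda>x. x - 1) (take ?m \<sigma>) @ drop ?m \<sigma> @ [?m])"
        using srt_pred gap d t by (auto simp: sorted_wrt_append)
      moreover have "\<forall>x\<in>set (map (\<lambda>x. x - 1) (take ?m \<sigma>) @ drop ?m \<sigma> @ [?m]). 0 < x"
        using d t m(1) by fastforce
      moreover have "sum_list (map (\<lambda>x. x - 1) (take ?m \<sigma>) @ drop ?m \<sigma> @ [?m]) = n"
        using sm_pred sum_list_take_drop[of ?m \<sigma>] sm by simp
      ultimately show ?thesis using len True by (simp add: S_def)
    qed
    with True show ?thesis
      by (auto simp: delta_basis_def Let_def len basis_vec_in_CS subspace_0[OF subspace_CS])
  next
    case False
    then have ml: "?m = l" using m(2) by simp
    have "map (\<lambda>x. x - 1) (take ?m \<sigma>) @ [?m] \<in> S (Suc l) n" if a: "?m < part \<sigma> l - 1"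
    proof -
      have t: "?m < x - 1" if "x \<in> set (take ?m \<sigma>)" for x
        using min[OF in_set_takeD[OF that]] a by simp
      have "sorted_wrt (>) (map (\<lambda>x. x - 1) (take ?m \<sigma>) @ [?m])"
        using srt_pred t by (auto simp: sorted_wrt_append)
      moreover have "\<forall>x\<in>set (map (\<lambda>x. x - 1) (take ?m \<sigma>) @ [?m]). 0 < x"
        using t m(1) by fastforce
      moreover have "sum_list (map (\<lambda>x. x - 1) (take ?m \<sigma>) @ [?m]) = n"
        using sm_pred sm ml len by simp
      ultimately show ?thesis using len ml by (simp add: S_def)
    qed
    with ml show ?thesis
      by (auto simp: delta_basis_def Let_def len basis_vec_in_CS subspace_0[OF subspace_CS])
  qed
qed

lemma delta_star_basis_in_CS:
  assumes "\<sigma> \<in> S l n" "0 < l"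
  shows "delta_star_basis \<sigma> \<in> CS (l - 1) n"
proof -
  let ?m = "m_stat \<sigma>" and ?r = "part \<sigma> l" and ?b = "butlast \<sigma>"
  let ?t = "map (\<lambda>x. x + 1) (take ?r ?b) @ drop ?r ?b"
  have len: "length \<sigma> = l" and srt: "sorted_wrt (>) \<sigma>" and pos: "\<forall>x\<in>set \<sigma>. 0 < x"
    and sm: "sum_list \<sigma> = n" using assms by (auto simp: S_def)
  note m = m_stat_props[of \<sigma>, unfolded len, OF \<open>0 < l\<close>]
  have "\<sigma> \<noteq> []" using len \<open>0 < l\<close> by auto
  then have split: "\<sigma> = ?b @ [?r]"
    using len by (metis append_butlast_last_id last_conv_nth part_def)
  have srtb: "sorted_wrt (>) ?b" using srt by (subst (asm) split) (simp add: sorted_wrt_append)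
  have smb: "sum_list ?b + ?r = n" using sm by (subst (asm) split) simp
  have *: "?t \<in> S (l - 1) n" if "?r < l"
  proof -
    have "sorted_wrt (>) (take ?r ?b @ drop ?r ?b)" using srtb by simp
    then have "sorted_wrt (>) ?t"
      unfolding sorted_wrt_append sorted_wrt_map by (auto intro: less_SucI)
    moreover have "\<forall>x\<in>set ?t. 0 < x" using pos by (auto dest!: in_set_dropD in_set_butlastD)
    moreover have "sum_list ?t = n"
      using sum_list_take_drop[of ?r ?b] smb that len by (simp only: sum_list_append sum_list_succ) simp
    ultimately show ?thesis using len that by (simp add: S_def)
  qed
  show ?thesis
    using * m(2)
    by (auto simp: delta_star_basis_def Let_def len basis_vec_in_CS subspace_0[OF subspace_CS])
qed

lemma delta_in_CS: "0 < l \<Longrightarrow> v \<in> CS l n \<Longrightarrow> delta v \<in> CS (Suc l) n"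
  unfolding delta_def linear_extension_def
  by (rule subspace_sum[OF subspace_CS], rule subspace_scale[OF subspace_CS], rule delta_basis_in_CS)
    (auto simp: CS_def)

lemma delta_star_in_CS: "0 < l \<Longrightarrow> v \<in> CS l n \<Longrightarrow> delta_star v \<in> CS (l - 1) n"
  unfolding delta_star_def linear_extension_def
  by (rule subspace_sum[OF subspace_CS], rule subspace_scale[OF subspace_CS], rule delta_star_basis_in_CS)
    (auto simp: CS_def)

end

theory Submission
  imports Defs
begin

text \<open>Basis vectors are nonzero, so each map kills a partition exactly in its explicit zero
  cases. For m < l these are n_l \<le> m and m < n_l, which exclude each other. For m = l they are
  n_l \<le> m + 1 and m \<le> n_l, which leave just n_l = m and n_l = m + 1.\<close>

lemma basis_vec_neq_0 [simp]: "basis_vec \<sigma> \<noteq> 0"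
  by (metis basis_vec_def lookup_single_eq lookup_zero zero_neq_one)

text \<open>Truncated subtraction is harmless: \<open>p - 1 \<le> m\<close> and
  \<open>p \<le> m + 1\<close> agree on naturals, even at p = 0.\<close>

lemma delta_basis_eq_0_iff:
  "delta_basis \<sigma> = 0 \<longleftrightarrow>
    (if m_stat \<sigma> < length \<sigma> then part \<sigma> (length \<sigma>) \<le> m_stat \<sigma>
     else part \<sigma> (length \<sigma>) \<le> m_stat \<sigma> + 1)"
  by (auto simp: delta_basis_def Let_def)

lemma delta_star_basis_eq_0_iff:
  "delta_star_basis \<sigma> = 0 \<longleftrightarrow>
    (if m_stat \<sigma> < length \<sigma> then m_stat \<sigma> < part \<sigma> (length \<sigma>)
     else m_stat \<sigma> \<le> part \<sigma> (length \<sigma>))"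
  by (auto simp: delta_star_basis_def Let_def)

theorem proposition4:
  fixes n l :: nat and \<sigma> :: "nat list"
  assumes "1 \<le> n" and "1 \<le> l"
    and "\<sigma> \<in> S l n"
  shows "(delta (basis_vec \<sigma>) = 0 \<and> delta_star (basis_vec \<sigma>) = 0) \<longleftrightarrow>
    (m_stat \<sigma> = l \<and> part \<sigma> l = m_stat \<sigma>) \<or>
    (m_stat \<sigma> = l \<and> part \<sigma> l = m_stat \<sigma> + 1)"
proof -
  have len: "length \<sigma> = l" using assms(3) by (simp add: S_def)
  \<comment> \<open>This bound makes the \<open>else\<close> branches, where m < l fails, the case m
    = l.\<close>
  have "m_stat \<sigma> \<le> l" using m_stat_props(2)[of \<sigma>] assms(2) len by simp
  then show ?thesis
    by (auto simp: delta_def delta_star_def delta_basis_eq_0_iff delta_star_basis_eq_0_iff len)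
qed

end
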